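(* Let $A\in\mathbb{R}^{n\times n}$, $B\in\mathbb{R}^{n\times m}$ and consider the discrete-time linear system $\Sigma: x^+=Ax+Bu$. Let $X\subseteq\mathbb{R}^n$ and $U\subseteq\mathbb{R}^m$ be compact convex sets (state and input constraint sets). Suppose $x_0\in X$ is open-loop convex feasible with respect to $(X,U)$, and let $\epsilon>0$, $\mathbf{u}:\mathbb{N}_{\ge0}\to U$ and $N>n+1$ be such that $\Phi(t,x_0,\mathbf{u})\in X$ for all $0\le t\le N-1$ and $\Phi(N,x_0,\mathbf{u})+\mathcal{B}_\epsilon(0)\subseteq\mathrm{ch}\left(\bigcup_{t=0}^{N-1}\{\Phi(t,x_0,\mathbf{u})\}\right)$. Then: - the set $H=\mathrm{ch}\left(\Phi(0,x_0,\mathbf{u}),\dots,\Phi(N-1,x_0,\mathbf{u})\right)$ is a controlled invariant for $\Sigma$ and constraint set $(X,U)$; - the sequence defined by $H_0=H$, $H_{t+1}=\mathrm{Pre}_\Sigma(H_t,X,U)$ is composed of controlled invariant sets for $\Sigma$ and constraint set $(X,U)$ and converges in the Hausdorff metric to the maximal controlled invariant set for $\Sigma$ and constraint set $(X,U)$.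
   Context: $\mathrm{ch}$ denotes convex hull; $\mathcal{B}_\epsilon(0)=\{z\in\mathbb{R}^n\mid\|z\|\le\epsilon\}$ (Euclidean norm). Trajectories: $\Phi(0,x_0,\mathbf{u})=x_0$, $\Phi(t+1,x_0,\mathbf{u})=A\Phi(t,x_0,\mathbf{u})+B\mathbf{u}(t)$. Open-loop convex feasible: $x_0\in X$ is open-loop convex feasible with respect to $(X,U)$ if there exist $\epsilon>0$, $\mathbf{u}:\mathbb{N}_{\ge0}\to U$ and an integer $N>n+1$ satisfying the two conditions written in the claim. Controlled invariant: a set $S$ is a controlled invariant for $\Sigma$ and $(X,U)$ if $S\subseteq X$ and for every $x\in S$ there exists $u\in U$ with $Ax+Bu\in S$. The maximal controlled invariant set is the controlled invariant for $\Sigma$ and $(X,U)$ that contains every controlled invariant for $\Sigma$ and $(X,U)$ (it exists because controlled invariance is stable under unions). One-step backward reachable set: for $H\subseteq\mathbb{R}^n$, $\mathrm{Pre}_\Sigma(H,X,U)=\{x\in X\mid\exists u\in U,\ Ax+Bu\in H\}$. *)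

theory Defs
  imports "HOL-Analysis.Analysis"
begin

primrec traj ::
  "real^'n^'n \<Rightarrow> real^'m^'n \<Rightarrow> nat \<Rightarrow> real^'n \<Rightarrow> (nat \<Rightarrow> real^'m) \<Rightarrow> real^'n" where
  "traj A B 0 x0 u = x0"
| "traj A B (Suc t) x0 u = A *v traj A B t x0 u + B *v u t"

definition open_loop_convex_feasible ::
  "real^'n^'n \<Rightarrow> real^'m^'n \<Rightarrow> (real^'n) set \<Rightarrow> (real^'m) set \<Rightarrow> real^'n \<Rightarrow> bool" where
  "open_loop_convex_feasible A B X U x0 \<longleftrightarrow>
     x0 \<in> X \<and>
     (\<exists>\<epsilon>>0. \<exists>u. \<exists>N>CARD('n) + 1.
        (\<forall>t. u t \<in> U) \<and>
        (\<forall>t\<le>N - 1. traj A B t x0 u \<in> X) \<and>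
        (\<lambda>z. traj A B N x0 u + z) ` cball 0 \<epsilon>
          \<subseteq> convex hull (\<Union>t\<in>{0..N - 1}. {traj A B t x0 u}))"

definition controlled_invariant ::
  "real^'n^'n \<Rightarrow> real^'m^'n \<Rightarrow> (real^'n) set \<Rightarrow> (real^'m) set \<Rightarrow> (real^'n) set \<Rightarrow> bool" where
  "controlled_invariant A B X U S \<longleftrightarrow>
     S \<subseteq> X \<and> (\<forall>x\<in>S. \<exists>u\<in>U. A *v x + B *v u \<in> S)"

text \<open>The greatest element, with respect to inclusion, among the controlled invariant sets.
  It exists for all \<open>A\<close>, \<open>B\<close>, \<open>X\<close>, \<open>U\<close>, as the lemmas below show, so the
  \<^const>\<open>Greatest\<close> operator is never applied outside its domain.\<close>

definition max_controlled_invariant ::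
  "real^'n^'n \<Rightarrow> real^'m^'n \<Rightarrow> (real^'n) set \<Rightarrow> (real^'m) set \<Rightarrow> (real^'n) set" where
  "max_controlled_invariant A B X U = (GREATEST S. controlled_invariant A B X U S)"

lemma controlled_invariant_Union:
  assumes "\<And>S. S \<in> F \<Longrightarrow> controlled_invariant A B X U S"
  shows "controlled_invariant A B X U (\<Union>F)"
  using assms unfolding controlled_invariant_def by blast

lemma max_controlled_invariant_eq:
  "max_controlled_invariant A B X U = \<Union>{S. controlled_invariant A B X U S}"
  unfolding max_controlled_invariant_def
  by (rule Greatest_equality) (auto intro: controlled_invariant_Union)

lemma controlled_invariant_max:
  "controlled_invariant A B X U (max_controlled_invariant A B X U)"
  unfolding max_controlled_invariant_eq by (auto intro: controlled_invariant_Union)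

lemma max_controlled_invariant_greatest:
  "controlled_invariant A B X U S \<Longrightarrow> S \<subseteq> max_controlled_invariant A B X U"
  unfolding max_controlled_invariant_eq by blast

definition Pre ::
  "real^'n^'n \<Rightarrow> real^'m^'n \<Rightarrow> (real^'n) set \<Rightarrow> (real^'n) set \<Rightarrow> (real^'m) set \<Rightarrow> (real^'n) set" where
  "Pre A B H X U = {x \<in> X. \<exists>u\<in>U. A *v x + B *v u \<in> H}"

primrec Pre_seq ::
  "real^'n^'n \<Rightarrow> real^'m^'n \<Rightarrow> (real^'n) set \<Rightarrow> (real^'n) set \<Rightarrow> (real^'m) set \<Rightarrow> nat \<Rightarrow> (real^'n) set"
where
  "Pre_seq A B H X U 0 = H"
| "Pre_seq A B H X U (Suc t) = Pre A B (Pre_seq A B H X U t) X U"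

definition hausdorff_dist :: "'a::metric_space set \<Rightarrow> 'a set \<Rightarrow> real" where
  "hausdorff_dist S T = max (SUP x\<in>S. infdist x T) (SUP y\<in>T. infdist y S)"

text \<open>Convergence in the space of nonempty compact sets, on which \<^const>\<open>hausdorff_dist\<close> is a
  metric. Membership in that space is part of the definition because outside it the suprema may
  range over unbounded or empty sets, and \<^const>\<open>infdist\<close> to the empty set is \<open>0\<close>.\<close>

definition hausdorff_converges :: "(nat \<Rightarrow> 'a::metric_space set) \<Rightarrow> 'a set \<Rightarrow> bool" where
  "hausdorff_converges S L \<longleftrightarrow>
     (\<forall>t. compact (S t) \<and> S t \<noteq> {}) \<and> compact L \<and> L \<noteq> {} \<and>
     (\<lambda>t. hausdorff_dist (S t) L) \<longlonglongrightarrow> 0"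

end

theory Submission
  imports Defs
begin

text \<open>
  Write \<open>x\<^sub>t\<close> for the given trajectory and \<open>M\<close> for the maximal controlled invariant set. Since \<open>x\<^sub>N\<close>
  is interior to \<open>H\<close>, mixing controls steers every point of \<open>H\<close> inside \<open>H\<close>, in \<open>N\<close> steps, to a
  point having a ball of a uniform radius \<open>\<eta>\<close> around it in \<open>H\<close>. Hence, for some \<open>q < 1\<close>, a point
  \<open>q h + (1 - q) z\<close> with \<open>h \<in> H\<close> and \<open>z \<in> M\<close> can be steered into \<open>H\<close> in \<open>N\<close> steps, the perturbation
  by \<open>M\<close> being absorbed by the ball. Iterating, \<open>q\<^sup>k H + (1 - q\<^sup>k) M\<close> lies in
  \<open>H\<^bsub>k N\<^esub>\<close>, so the distance of \<open>H\<^bsub>k N\<^esub>\<close> to \<open>M\<close> decays geometrically.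
\<close>

section \<open>Convexity, compactness and monotonicity of backward reachable sets\<close>

lemma system_step_convex_combination:
  fixes A :: "real^'n^'n" and B :: "real^'m^'n"
  shows "A *v (r *\<^sub>R x + s *\<^sub>R y) + B *v (r *\<^sub>R v + s *\<^sub>R w)
    = r *\<^sub>R (A *v x + B *v v) + s *\<^sub>R (A *v y + B *v w)"
  by (simp add: matrix_vector_right_distrib matrix_vector_mult_scaleR scaleR_add_right)

lemma Pre_mono: "S \<subseteq> T \<Longrightarrow> Pre A B S X U \<subseteq> Pre A B T X U"
  unfolding Pre_def by blast

lemma Pre_seq_mono: "S \<subseteq> T \<Longrightarrow> Pre_seq A B S X U t \<subseteq> Pre_seq A B T X U t"
  by (induction t) (simp_all add: Pre_mono)

lemma Pre_seq_add:
  "Pre_seq A B (Pre_seq A B S X U s) X U t = Pre_seq A B S X U (s + t)"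
  by (induction t) simp_all

lemma convex_Pre:
  assumes "convex S" "convex X" "convex U"
  shows "convex (Pre A B S X U)"
proof (rule convexI)
  fix x y and r s :: real
  assume x: "x \<in> Pre A B S X U" and y: "y \<in> Pre A B S X U" and rs: "0 \<le> r" "0 \<le> s" "r + s = 1"
  from x obtain v where v: "x \<in> X" "v \<in> U" "A *v x + B *v v \<in> S"
    unfolding Pre_def by blast
  from y obtain w where w: "y \<in> X" "w \<in> U" "A *v y + B *v w \<in> S"
    unfolding Pre_def by blast
  have "A *v (r *\<^sub>R x + s *\<^sub>R y) + B *v (r *\<^sub>R v + s *\<^sub>R w) \<in> S"
    unfolding system_step_convex_combination using assms(1) v w rs by (simp add: convexD)
  moreover have "r *\<^sub>R x + s *\<^sub>R y \<in> X" "r *\<^sub>R v + s *\<^sub>R w \<in> U"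
    using assms(2,3) v w rs by (simp_all add: convexD)
  ultimately show "r *\<^sub>R x + s *\<^sub>R y \<in> Pre A B S X U"
    unfolding Pre_def by blast
qed

lemma convex_Pre_seq:
  "convex S \<Longrightarrow> convex X \<Longrightarrow> convex U \<Longrightarrow> convex (Pre_seq A B S X U t)"
  by (induction t) (simp_all add: convex_Pre)

text \<open>Projecting to the state the pairs in the compact set \<open>X \<times> U\<close> that
  satisfy the closed condition \<open>A *v x + B *v u \<in> S\<close> gives the set.\<close>

lemma compact_Pre:
  fixes A :: "real^'n^'n" and B :: "real^'m^'n"
  assumes "compact X" "compact U" "closed S"
  shows "compact (Pre A B S X U)"
proof -
  let ?f = "\<lambda>p :: (real^'n) \<times> (real^'m). A *v fst p + B *v snd p"
  have "continuous_on UNIV ?f"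
    by (intro continuous_on_add matrix_vector_mult_linear_continuous_on
        continuous_on_compose2[OF matrix_vector_mult_linear_continuous_on]
        continuous_on_fst continuous_on_snd continuous_on_id) auto
  then have "closed (?f -` S)"
    using assms(3) by (simp add: closed_vimage)
  then have "compact (fst ` ((X \<times> U) \<inter> ?f -` S))"
    using assms
    by (intro compact_continuous_image compact_Int_closed compact_Times
        continuous_on_fst continuous_on_id)
  moreover have "fst ` ((X \<times> U) \<inter> ?f -` S) = Pre A B S X U"
    unfolding Pre_def by force
  ultimately show ?thesis by simp
qed

lemma compact_Pre_seq:
  "compact X \<Longrightarrow> compact U \<Longrightarrow> compact S \<Longrightarrow> compact (Pre_seq A B S X U t)"
  by (induction t) (simp_all add: compact_Pre compact_imp_closed)

text \<open>Recast as an inclusion, invariance is carried along \<open>Pre_seq\<close> by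
  monotonicity of \<open>Pre\<close>.\<close>

lemma controlled_invariant_iff_subset_Pre:
  "controlled_invariant A B X U S \<longleftrightarrow> S \<subseteq> Pre A B S X U"
  unfolding controlled_invariant_def Pre_def by blast

lemma controlled_invariant_Pre_seq:
  assumes "controlled_invariant A B X U S"
  shows "controlled_invariant A B X U (Pre_seq A B S X U t)"
  using assms unfolding controlled_invariant_iff_subset_Pre
  by (induction t) (simp_all add: Pre_mono)

lemma Pre_seq_increasing:
  assumes "controlled_invariant A B X U S" "s \<le> t"
  shows "Pre_seq A B S X U s \<subseteq> Pre_seq A B S X U t"
proof -
  have "Pre_seq A B S X U t \<subseteq> Pre_seq A B S X U (Suc t)" for t
    using controlled_invariant_Pre_seq[OF assms(1)]
    unfolding controlled_invariant_iff_subset_Pre by simp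
  then show ?thesis
    using assms(2) by (rule lift_Suc_mono_le)
qed

text \<open>Since \<open>Pre\<close> of a closed set is closed, the closure of the maximal set is
  again controlled invariant, and maximality forces it back into the set.\<close>

lemma compact_max_controlled_invariant:
  assumes "compact X" "compact U"
  shows "compact (max_controlled_invariant A B X U)"
proof -
  let ?M = "max_controlled_invariant A B X U"
  have ci: "controlled_invariant A B X U ?M"
    by (rule controlled_invariant_max)
  have "?M \<subseteq> Pre A B ?M X U"
    using ci by (simp add: controlled_invariant_iff_subset_Pre)
  also have "\<dots> \<subseteq> Pre A B (closure ?M) X U"
    by (rule Pre_mono) (rule closure_subset)
  finally have "closure ?M \<subseteq> Pre A B (closure ?M) X U"
    using compact_Pre[OF assms closed_closure]
    by (intro closure_minimal compact_imp_closed)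
  then have "closure ?M \<subseteq> ?M"
    by (intro max_controlled_invariant_greatest) (simp add: controlled_invariant_iff_subset_Pre)
  then have "closed ?M"
    by (simp add: closure_subset_eq)
  moreover have "bounded ?M"
    using ci bounded_subset compact_imp_bounded[OF assms(1)]
    unfolding controlled_invariant_def by blast
  ultimately show ?thesis
    by (simp add: compact_eq_bounded_closed)
qed

section \<open>Balls inside convex sets and their persistence under the dynamics\<close>

lemma cball_convex_combination_subset:
  fixes C :: "'a::real_normed_vector set"
  assumes "convex C" "a \<in> C" "cball b \<eta> \<subseteq> C" "0 \<le> r" "0 < s" "r + s = 1"
  shows "cball (r *\<^sub>R a + s *\<^sub>R b) (s * \<eta>) \<subseteq> C"
proof
  fix w assume "w \<in> cball (r *\<^sub>R a + s *\<^sub>R b) (s * \<eta>)"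
  then have w: "norm (w - (r *\<^sub>R a + s *\<^sub>R b)) \<le> s * \<eta>"
    by (simp add: dist_norm norm_minus_commute)
  define v where "v = (1 / s) *\<^sub>R (w - (r *\<^sub>R a + s *\<^sub>R b))"
  have "norm v \<le> \<eta>"
    using w \<open>0 < s\<close> by (simp add: v_def pos_divide_le_eq mult.commute)
  then have "b + v \<in> C"
    using assms(3) by (auto simp: dist_norm)
  then have "r *\<^sub>R a + s *\<^sub>R (b + v) \<in> C"
    using assms by (intro convexD) auto
  moreover have "r *\<^sub>R a + s *\<^sub>R (b + v) = w"
    using \<open>0 < s\<close> by (simp add: v_def scaleR_add_right)
  ultimately show "w \<in> C" by simp
qed

text \<open>A displacement common to both centres also displaces their mixture. Reachability of such
  a target can therefore be checked at the vertices of a hull.\<close>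

lemma convex_cball_subset:
  fixes C :: "'a::real_normed_vector set"
  assumes "convex C"
  shows "convex {y. cball y \<eta> \<subseteq> C}"
proof (rule convexI, safe)
  fix x y w and r s :: real
  assume x: "cball x \<eta> \<subseteq> C" and y: "cball y \<eta> \<subseteq> C" and rs: "0 \<le> r" "0 \<le> s" "r + s = 1"
    and w: "w \<in> cball (r *\<^sub>R x + s *\<^sub>R y) \<eta>"
  define v where "v = w - (r *\<^sub>R x + s *\<^sub>R y)"
  have "norm v \<le> \<eta>"
    using w by (simp add: v_def dist_norm norm_minus_commute)
  then have "x + v \<in> C" "y + v \<in> C"
    using x y by (auto simp: dist_norm)
  then have "r *\<^sub>R (x + v) + s *\<^sub>R (y + v) \<in> C"
    using assms rs by (intro convexD) auto
  moreover have "r *\<^sub>R (x + v) + s *\<^sub>R (y + v) = (r *\<^sub>R x + s *\<^sub>R y) + (r + s) *\<^sub>R v"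
    by (simp add: algebra_simps)
  ultimately show "w \<in> C"
    using rs by (simp add: v_def)
qed

lemma bounded_dist_bound:
  fixes C :: "'a::metric_space set"
  assumes "bounded C"
  obtains D where "D > 0" "\<And>x y. x \<in> C \<Longrightarrow> y \<in> C \<Longrightarrow> dist x y \<le> D"
proof
  show "diameter C + 1 > 0"
    using diameter_ge_0[OF assms] by linarith
  show "dist x y \<le> diameter C + 1" if "x \<in> C" "y \<in> C" for x y
    using diameter_bounded_bound[OF assms that] by linarith
qed

text \<open>A point deep inside \<open>H\<close> is a convex combination, with weight on \<open>c\<close> bounded below, of \<open>c\<close>
  and another point of \<open>H\<close>; mixing the two controls keeps a definite share of the ball around the
  successor of \<open>c\<close>.\<close>

lemma interior_margin_step:
  fixes A :: "real^'n^'n" and B :: "real^'m^'n"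
  assumes H: "convex H" "bounded H" "controlled_invariant A B H U H" and "convex U"
    and c: "c \<in> H" "w \<in> U" "cball (A *v c + B *v w) \<epsilon> \<subseteq> H" "\<epsilon> > 0" and "\<eta> > 0"
  shows "\<exists>\<eta>'>0. {y. cball y \<eta> \<subseteq> H} \<subseteq> Pre A B {y. cball y \<eta>' \<subseteq> H} H U"
proof -
  obtain D where D: "D > 0" "\<And>x y. x \<in> H \<Longrightarrow> y \<in> H \<Longrightarrow> dist x y \<le> D"
    using bounded_dist_bound[OF H(2)] by blast
  \<comment> \<open>The weights satisfy \<open>r * (\<eta> / D) = s\<close>, which makes
    \<open>y\<close> the mixture of \<open>c\<close> and the point \<open>y'\<close> below.\<close>
  define s where "s = \<eta> / (\<eta> + D)"
  define r where "r = D / (\<eta> + D)"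
  have rs: "0 < s" "0 < r" "r + s = 1"
    using \<open>\<eta> > 0\<close> D(1) by (simp_all add: s_def r_def add_divide_distrib[symmetric] add.commute)
  have "y \<in> Pre A B {y. cball y (s * \<epsilon>) \<subseteq> H} H U" if y: "cball y \<eta> \<subseteq> H" for y
  proof -
    have yH: "y \<in> H"
      using y \<open>\<eta> > 0\<close> by auto
    \<comment> \<open>\<open>y'\<close> is \<open>y\<close> pushed away from \<open>c\<close> by at
      most \<open>\<eta>\<close>, because \<open>dist y c \<le> D\<close>; so it is still in
      \<open>H\<close>.\<close>
    define y' where "y' = y + (\<eta> / D) *\<^sub>R (y - c)"
    have "dist y y' = \<eta> * (dist y c / D)"
      using \<open>\<eta> > 0\<close> D(1) by (simp add: y'_def dist_norm)
    also have "\<dots> \<le> \<eta> * 1"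
      using D(2)[OF yH c(1)] \<open>\<eta> > 0\<close> D(1) by (intro mult_left_mono) simp_all
    finally have "y' \<in> H"
      using y by auto
    then obtain v where v: "v \<in> U" "A *v y' + B *v v \<in> H"
      using H(3) unfolding controlled_invariant_def by blast
    have "r * (\<eta> / D) = s"
      using D(1) by (simp add: r_def s_def)
    then have "r *\<^sub>R y' + s *\<^sub>R c = (r + s) *\<^sub>R y"
      by (simp add: y'_def algebra_simps)
    then have y_eq: "y = r *\<^sub>R y' + s *\<^sub>R c"
      using rs by simp
    have "cball (A *v y + B *v (r *\<^sub>R v + s *\<^sub>R w)) (s * \<epsilon>) \<subseteq> H"
      unfolding y_eq system_step_convex_combination
      using rs v c by (intro cball_convex_combination_subset[OF H(1)]) simp_all
    moreover have "r *\<^sub>R v + s *\<^sub>R w \<in> U"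
      using rs v c \<open>convex U\<close> by (intro convexD) simp_all
    ultimately show ?thesis
      using yH unfolding Pre_def by blast
  qed
  moreover have "s * \<epsilon> > 0"
    using rs c by simp
  ultimately show ?thesis by blast
qed

text \<open>The margin may shrink at each step, but it stays positive and is the same for all
  starting points.\<close>

lemma interior_margin_steps:
  fixes A :: "real^'n^'n" and B :: "real^'m^'n"
  assumes H: "convex H" "bounded H" "controlled_invariant A B H U H" and "convex U"
    and c: "c \<in> H" "w \<in> U" "cball (A *v c + B *v w) \<epsilon> \<subseteq> H" "\<epsilon> > 0" and "\<eta> > 0"
  shows "\<exists>\<eta>'>0. {y. cball y \<eta> \<subseteq> H} \<subseteq> Pre_seq A B {y. cball y \<eta>' \<subseteq> H} H U t"
proof (induction t)
  case 0
  then show ?case using \<open>\<eta> > 0\<close> by auto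
next
  case (Suc t)
  then obtain \<eta>1 where "\<eta>1 > 0"
    and \<eta>1: "{y. cball y \<eta> \<subseteq> H} \<subseteq> Pre_seq A B {y. cball y \<eta>1 \<subseteq> H} H U t"
    by blast
  obtain \<eta>2 where "\<eta>2 > 0"
    and \<eta>2: "{y. cball y \<eta>1 \<subseteq> H} \<subseteq> Pre_seq A B {y. cball y \<eta>2 \<subseteq> H} H U (Suc 0)"
    using interior_margin_step[OF assms(1-8) \<open>\<eta>1 > 0\<close>] by auto
  have "{y. cball y \<eta> \<subseteq> H} \<subseteq> Pre_seq A B {y. cball y \<eta>2 \<subseteq> H} H U (Suc 0 + t)"
    using \<eta>1 Pre_seq_mono[OF \<eta>2, of A B H U t] unfolding Pre_seq_add by (rule order_trans)
  then show ?case using \<open>\<eta>2 > 0\<close> by auto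
qed

text \<open>By linearity, mixing with fixed weights the states and controls of a trajectory in
  \<open>H\<close> and of one in \<open>M\<close> gives an admissible trajectory.\<close>

lemma Pre_seq_convex_combination:
  fixes A :: "real^'n^'n" and B :: "real^'m^'n"
  assumes "convex X" "convex U" "H \<subseteq> X" "controlled_invariant A B X U M"
    and rs: "0 \<le> r" "0 \<le> s" "r + s = 1"
    and "y \<in> Pre_seq A B S H U t" "z \<in> M"
  shows "r *\<^sub>R y + s *\<^sub>R z \<in> Pre_seq A B {r *\<^sub>R a + s *\<^sub>R b |a b. a \<in> S \<and> b \<in> M} X U t"
  using assms(8,9)
proof (induction t arbitrary: y z)
  case 0
  then show ?case by auto
next
  case (Suc t)
  then obtain v where v: "y \<in> H" "v \<in> U" "A *v y + B *v v \<in> Pre_seq A B S H U t"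
    by (auto simp: Pre_def)
  obtain w where w: "z \<in> X" "w \<in> U" "A *v z + B *v w \<in> M"
    using assms(4) Suc.prems unfolding controlled_invariant_def by blast
  note Suc.IH[OF v(3) w(3), folded system_step_convex_combination]
  moreover have "r *\<^sub>R y + s *\<^sub>R z \<in> X" "r *\<^sub>R v + s *\<^sub>R w \<in> U"
    using assms(1-3) rs v w by (auto intro: convexD)
  ultimately show ?case by (auto simp: Pre_def)
qed

section \<open>Hausdorff convergence of increasing sequences\<close>

lemma hausdorff_dist_subset_bounds:
  assumes "S \<noteq> {}" "S \<subseteq> T" "\<And>y. y \<in> T \<Longrightarrow> \<exists>x\<in>S. dist y x \<le> e"
  shows "0 \<le> hausdorff_dist S T" "hausdorff_dist S T \<le> e"
proof -
  have "(SUP x\<in>S. infdist x T) = (SUP x\<in>S. 0)"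
    using assms(2) by (intro SUP_cong) auto
  then have S: "(SUP x\<in>S. infdist x T) = 0"
    using assms(1) by simp
  have T: "(SUP y\<in>T. infdist y S) \<le> e"
  proof (rule cSUP_least)
    show "T \<noteq> {}" using assms(1,2) by blast
    show "infdist y S \<le> e" if "y \<in> T" for y
      using assms(3)[OF that] infdist_le2 by blast
  qed
  obtain y where "y \<in> S" using assms(1) by blast
  then have "0 \<le> e"
    using assms(2) assms(3)[of y] by (meson order_trans subsetD zero_le_dist)
  then show "0 \<le> hausdorff_dist S T" "hausdorff_dist S T \<le> e"
    unfolding hausdorff_dist_def S using T by auto
qed

text \<open>Closeness to \<open>L\<close> reached at one index persists at all later ones, so one
  good index for each \<open>e\<close> suffices.\<close>

lemma hausdorff_converges_increasing:
  assumes "\<And>t. compact (S t)" "\<And>t. S t \<noteq> {}" "compact L" "\<And>t. S t \<subseteq> L"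
    and "\<And>s t. s \<le> t \<Longrightarrow> S s \<subseteq> S t"
    and "\<And>e. e > 0 \<Longrightarrow> \<exists>t. \<forall>y\<in>L. \<exists>x\<in>S t. dist y x \<le> e"
  shows "hausdorff_converges S L"
  unfolding hausdorff_converges_def
proof (intro conjI allI)
  show "(\<lambda>t. hausdorff_dist (S t) L) \<longlonglongrightarrow> 0"
  proof (rule LIMSEQ_I)
    fix e :: real assume "e > 0"
    then obtain t0 where t0: "\<forall>y\<in>L. \<exists>x\<in>S t0. dist y x \<le> e / 2"
      using assms(6)[of "e / 2"] by auto
    have "norm (hausdorff_dist (S t) L - 0) < e" if "t0 \<le> t" for t
    proof -
      have "\<exists>x\<in>S t. dist y x \<le> e / 2" if "y \<in> L" for y
        using t0 that assms(5)[OF \<open>t0 \<le> t\<close>] by blast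
      note hausdorff_dist_subset_bounds[OF assms(2,4) this]
      then show ?thesis using \<open>e > 0\<close> by auto
    qed
    then show "\<exists>t0. \<forall>t\<ge>t0. norm (hausdorff_dist (S t) L - 0) < e" by blast
  qed
qed (use assms in blast)+

text \<open>The weight left on \<open>H\<close> decays geometrically because points with margin \<open>\<eta>\<close> absorb a fixed
  fraction \<open>\<alpha>\<close> of any point of \<open>M\<close> every \<open>n\<close> steps.\<close>

lemma Pre_seq_approaches:
  fixes A :: "real^'n^'n" and B :: "real^'m^'n"
  assumes "convex X" "bounded X" "convex U" "H \<subseteq> X"
    and M: "controlled_invariant A B X U M"
    and "\<eta> > 0" and n: "H \<subseteq> Pre_seq A B {y. cball y \<eta> \<subseteq> H} H U n"
    and "H \<noteq> {}" and "e > 0"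
  shows "\<exists>t. \<forall>z\<in>M. \<exists>y\<in>Pre_seq A B H X U t. dist z y \<le> e"
proof -
  obtain D where D: "D > 0" "\<And>x y. x \<in> X \<Longrightarrow> y \<in> X \<Longrightarrow> dist x y \<le> D"
    using bounded_dist_bound[OF assms(2)] by blast
  have MX: "M \<subseteq> X"
    using M by (simp add: controlled_invariant_def)
  \<comment> \<open>\<open>\<alpha>\<close> is chosen so that moving the fraction
    \<open>\<alpha>\<close> of the way between two points of \<open>X\<close> covers at most
    \<open>\<alpha> * D \<le> \<eta>\<close>.\<close>
  define q where "q = D / (\<eta> + D)"
  define \<alpha> where "\<alpha> = \<eta> / (\<eta> + D)"
  have q: "0 < q" "q < 1" "0 < \<alpha>" "\<alpha> * D \<le> \<eta>"
    using \<open>\<eta> > 0\<close> D(1) by (simp_all add: q_def \<alpha>_def field_simps)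
  have q_\<alpha>: "q + \<alpha> = 1"
    using \<open>\<eta> > 0\<close> D(1) by (simp add: q_def \<alpha>_def add_divide_distrib[symmetric] add.commute)
  have absorb: "q *\<^sub>R a + \<alpha> *\<^sub>R b \<in> H" if a: "cball a \<eta> \<subseteq> H" and b: "b \<in> M" for a b
  proof -
    have "a \<in> X"
      using subsetD[OF a, of a] \<open>\<eta> > 0\<close> \<open>H \<subseteq> X\<close> by auto
    have "q *\<^sub>R a + \<alpha> *\<^sub>R b = (q + \<alpha>) *\<^sub>R a + \<alpha> *\<^sub>R (b - a)"
      by (simp add: algebra_simps)
    then have "dist a (q *\<^sub>R a + \<alpha> *\<^sub>R b) = \<alpha> * dist b a"
      using q q_\<alpha> by (simp add: dist_norm norm_minus_commute)
    also have "\<dots> \<le> \<alpha> * D"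
      using D(2)[of b a] \<open>a \<in> X\<close> b MX q by (intro mult_left_mono) auto
    finally show ?thesis
      using a q by auto
  qed
  have mix: "q ^ k *\<^sub>R h + (1 - q ^ k) *\<^sub>R z \<in> Pre_seq A B H X U (k * n)"
    if "h \<in> H" "z \<in> M" for k h z
    using that
  proof (induction k arbitrary: h z)
    case 0
    then show ?case by simp
  next
    case (Suc k)
    have qk: "0 \<le> q ^ Suc k" "q ^ Suc k \<le> 1"
      using q by (simp_all add: power_le_one del: power_Suc)
    let ?T = "{q ^ Suc k *\<^sub>R a + (1 - q ^ Suc k) *\<^sub>R b |a b. a \<in> {y. cball y \<eta> \<subseteq> H} \<and> b \<in> M}"
    have "?T \<subseteq> Pre_seq A B H X U (k * n)"
    proof safe
      fix a b assume a: "cball a \<eta> \<subseteq> H" and b: "b \<in> M"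
      \<comment> \<open>One factor \<open>q\<close> is spent on absorbing
        \<open>\<alpha> *\<^sub>R b\<close> into \<open>H\<close>; what remains is a mixture with
        weight \<open>q ^ k\<close> and the same \<open>b\<close>, as in the induction
        hypothesis.\<close>
      have "q ^ Suc k *\<^sub>R a + (1 - q ^ Suc k) *\<^sub>R b
        = q ^ k *\<^sub>R (q *\<^sub>R a + \<alpha> *\<^sub>R b) + (1 - q ^ k) *\<^sub>R b"
      proof -
        have \<alpha>: "\<alpha> = 1 - q" using q_\<alpha> by simp
        show ?thesis unfolding \<alpha> by (simp add: algebra_simps)
      qed
      then show "q ^ Suc k *\<^sub>R a + (1 - q ^ Suc k) *\<^sub>R b \<in> Pre_seq A B H X U (k * n)"
        using Suc.IH[OF absorb[OF a b] b] by simp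
    qed
    \<comment> \<open>The first \<open>n\<close> steps give the \<open>H\<close> component the
      margin \<open>\<eta>\<close> while the other component stays in \<open>M\<close>.\<close>
    moreover have "q ^ Suc k *\<^sub>R h + (1 - q ^ Suc k) *\<^sub>R z \<in> Pre_seq A B ?T X U n"
    proof (rule Pre_seq_convex_combination[OF assms(1,3,4) M qk(1)])
      show "h \<in> Pre_seq A B {y. cball y \<eta> \<subseteq> H} H U n"
        using Suc.prems(1) n by (rule subsetD[rotated])
    qed (use qk Suc.prems(2) in simp_all)
    ultimately have "q ^ Suc k *\<^sub>R h + (1 - q ^ Suc k) *\<^sub>R z
        \<in> Pre_seq A B (Pre_seq A B H X U (k * n)) X U n"
      by (rule subsetD[OF Pre_seq_mono])
    then show ?case
      by (simp add: Pre_seq_add add.commute)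
  qed
  obtain h where h: "h \<in> H"
    using \<open>H \<noteq> {}\<close> by blast
  obtain k where k: "q ^ k < e / D"
    using real_arch_pow_inv[of "e / D" q] \<open>e > 0\<close> D(1) q by auto
  have "\<exists>y\<in>Pre_seq A B H X U (k * n). dist z y \<le> e" if z: "z \<in> M" for z
  proof
    have "z - (q ^ k *\<^sub>R h + (1 - q ^ k) *\<^sub>R z) = q ^ k *\<^sub>R (z - h)"
      by (simp add: algebra_simps)
    then have "dist z (q ^ k *\<^sub>R h + (1 - q ^ k) *\<^sub>R z) = q ^ k * dist z h"
      using q by (simp add: dist_norm)
    also have "\<dots> \<le> (e / D) * D"
      using D(2)[of z h] h z MX \<open>H \<subseteq> X\<close> k q \<open>e > 0\<close> D(1) by (intro mult_mono) auto
    finally show "dist z (q ^ k *\<^sub>R h + (1 - q ^ k) *\<^sub>R z) \<le> e"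
      using D(1) by simp
  qed (rule mix[OF h z])
  then show ?thesis by blast
qed

section \<open>The convex hull of the trajectory\<close>

text \<open>Each generator steps to the next one, and the last into the hull by hypothesis;
  convexity of \<open>Pre\<close> extends this to the hull.\<close>

lemma controlled_invariant_convex_hull_traj:
  fixes A :: "real^'n^'n" and B :: "real^'m^'n"
  assumes "convex U" "\<And>t. u t \<in> U"
    and "traj A B (Suc K) x0 u \<in> convex hull ((\<lambda>t. traj A B t x0 u) ` {..K})" (is "_ \<in> ?H")
  shows "controlled_invariant A B ?H U ?H"
proof -
  have "traj A B t x0 u \<in> Pre A B ?H ?H U" if "t \<le> K" for t
  proof -
    have "traj A B (Suc t) x0 u \<in> ?H"
    proof (cases "t = K")
      case False
      with that have "Suc t \<in> {..K}" by simp
      then show ?thesis by (intro hull_inc imageI)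
    qed (use assms(3) in simp)
    then have "\<exists>v\<in>U. A *v traj A B t x0 u + B *v v \<in> ?H"
      using assms(2) by auto
    moreover have "traj A B t x0 u \<in> ?H"
      using that by (auto intro: hull_inc)
    ultimately show ?thesis by (simp add: Pre_def)
  qed
  then have "?H \<subseteq> Pre A B ?H ?H U"
    using assms(1) by (intro hull_minimal convex_Pre convex_convex_hull) auto
  then show ?thesis
    by (simp add: controlled_invariant_iff_subset_Pre)
qed

text \<open>The vertex at time \<open>t\<close> reaches the centre of the ball in
  \<open>Suc K - t\<close> steps and then retains a margin for \<open>t\<close> more. All vertices
  thus take \<open>Suc K\<close> steps, so convexity covers the hull.\<close>

lemma convex_hull_traj_reaches_interior:
  fixes A :: "real^'n^'n" and B :: "real^'m^'n"
  assumes "convex U" "\<And>t. u t \<in> U" "\<epsilon> > 0"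
    and ball: "cball (traj A B (Suc K) x0 u) \<epsilon> \<subseteq> convex hull ((\<lambda>t. traj A B t x0 u) ` {..K})"
      (is "_ \<subseteq> ?H")
  shows "\<exists>\<eta>>0. ?H \<subseteq> Pre_seq A B {y. cball y \<eta> \<subseteq> ?H} ?H U (Suc K)"
proof -
  let ?x = "\<lambda>t. traj A B t x0 u"
  let ?P = "\<lambda>\<eta>. {y. cball y \<eta> \<subseteq> ?H}"
  have "?x (Suc K) \<in> ?H"
    using ball \<open>\<epsilon> > 0\<close> by auto
  then have ci: "controlled_invariant A B ?H U ?H"
    by (rule controlled_invariant_convex_hull_traj[OF assms(1,2)])
  have xH: "?x t \<in> ?H" if "t \<le> K" for t
    using that by (auto intro: hull_inc)
  have bounded: "bounded ?H"
    by (intro bounded_convex_hull finite_imp_bounded) simp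
  \<comment> \<open>Here \<open>d\<close> counts steps back along the trajectory from its point at
    time \<open>Suc K\<close>; all earlier points are in \<open>?H\<close>, as the state constraint
    demands.\<close>
  have last: "?x (Suc K) \<in> Pre_seq A B S ?H U j \<Longrightarrow> d \<le> Suc K
      \<Longrightarrow> ?x (Suc K - d) \<in> Pre_seq A B S ?H U (d + j)" for S j d
  proof (induction d)
    case 0
    then show ?case by simp
  next
    case (Suc d)
    then have "?x (Suc (K - d)) \<in> Pre_seq A B S ?H U (d + j)"
      by (simp add: Suc_diff_le)
    then have "?x (K - d) \<in> Pre A B (Pre_seq A B S ?H U (d + j)) ?H U"
      using assms(2) xH[of "K - d"] unfolding Pre_def by auto
    then show ?case by simp
  qed
  have "\<exists>\<eta>>0. ?x t \<in> Pre_seq A B (?P \<eta>) ?H U (Suc K)" if "t \<le> K" for t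
  proof -
    have b: "cball (A *v ?x K + B *v u K) \<epsilon> \<subseteq> ?H"
      using ball by simp
    obtain \<eta> where "\<eta> > 0" and \<eta>: "?P \<epsilon> \<subseteq> Pre_seq A B (?P \<eta>) ?H U t"
      using interior_margin_steps[OF convex_convex_hull bounded ci assms(1) xH assms(2) b
          \<open>\<epsilon> > 0\<close> \<open>\<epsilon> > 0\<close>] by blast
    have "?x (Suc K) \<in> Pre_seq A B (?P \<eta>) ?H U t"
      using \<eta> ball by blast
    then have "?x (Suc K - (Suc K - t)) \<in> Pre_seq A B (?P \<eta>) ?H U (Suc K - t + t)"
      by (rule last) simp
    then show ?thesis
      using that \<open>\<eta> > 0\<close> by auto
  qed
  then obtain \<eta> where \<eta>: "\<And>t. t \<le> K \<Longrightarrow> \<eta> t > 0"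
      "\<And>t. t \<le> K \<Longrightarrow> ?x t \<in> Pre_seq A B (?P (\<eta> t)) ?H U (Suc K)"
    by metis
  \<comment> \<open>The finitely many vertices share the least margin, and a smaller margin only
    enlarges the target set.\<close>
  define m where "m = Min (\<eta> ` {..K})"
  have "m > 0"
    using \<eta>(1) unfolding m_def by (subst Min_gr_iff) auto
  have "?x t \<in> Pre_seq A B (?P m) ?H U (Suc K)" if "t \<le> K" for t
  proof -
    have "m \<le> \<eta> t"
      using that unfolding m_def by (intro Min_le) auto
    then have "?P (\<eta> t) \<subseteq> ?P m"
      using subset_cball by blast
    then show ?thesis
      using \<eta>(2)[OF that] by (rule subsetD[OF Pre_seq_mono])
  qed
  then have "?H \<subseteq> Pre_seq A B (?P m) ?H U (Suc K)"
    using assms(1) by (intro hull_minimal convex_Pre_seq convex_cball_subset convex_convex_hull) auto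
  then show ?thesis
    using \<open>m > 0\<close> by blast
qed

theorem theorem4:
  fixes A :: "real^'n^'n" and B :: "real^'m^'n"
    and X :: "(real^'n) set" and U :: "(real^'m) set"
    and x0 :: "real^'n" and u :: "nat \<Rightarrow> real^'m"
    and \<epsilon> :: real and N :: nat and H :: "(real^'n) set"
  assumes "compact X" and "convex X"
    and "compact U" and "convex U"
    and "x0 \<in> X"
    and "open_loop_convex_feasible A B X U x0"
    and "\<epsilon> > 0"
    and "\<forall>t. u t \<in> U"
    and "N > CARD('n) + 1"
    and "\<forall>t\<le>N - 1. traj A B t x0 u \<in> X"
    and "(\<lambda>z. traj A B N x0 u + z) ` cball 0 \<epsilon>
           \<subseteq> convex hull (\<Union>t\<in>{0..N - 1}. {traj A B t x0 u})"
  defines "H \<equiv> convex hull ((\<lambda>t. traj A B t x0 u) ` {0..N - 1})"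
  shows "controlled_invariant A B X U H \<and>
         (\<forall>t. controlled_invariant A B X U (Pre_seq A B H X U t)) \<and>
         hausdorff_converges (Pre_seq A B H X U) (max_controlled_invariant A B X U)"
proof -
  \<comment> \<open>As \<open>N\<close> is positive, the truncated subtraction in
    \<open>N - 1\<close> is exact.\<close>
  have N: "N = Suc (N - 1)"
    using assms(9) by simp
  have H_eq: "H = convex hull ((\<lambda>t. traj A B t x0 u) ` {..N - 1})"
    by (simp add: H_def atLeast0AtMost)
  have "(\<Union>t\<in>{0..N - 1}. {traj A B t x0 u}) = (\<lambda>t. traj A B t x0 u) ` {0..N - 1}"
    by blast
  then have "(+) (traj A B N x0 u) ` cball 0 \<epsilon> \<subseteq> H"
    using assms(11) by (simp add: H_def)
  then have ball: "cball (traj A B (Suc (N - 1)) x0 u) \<epsilon> \<subseteq> H"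
    unfolding N[symmetric] by (simp add: cball_translation[symmetric])
  have HX: "H \<subseteq> X"
    unfolding H_eq using assms(2,10) by (intro hull_minimal) auto
  have H_ne: "H \<noteq> {}"
    by (simp add: H_eq)
  have compact: "compact H"
    unfolding H_eq by (intro finite_imp_compact_convex_hull) simp
  have "traj A B (Suc (N - 1)) x0 u \<in> H"
    using ball assms(7) by auto
  \<comment> \<open>Invariance holds even with \<open>H\<close> as state constraint;
    \<open>H \<subseteq> X\<close> then relaxes it.\<close>
  then have "controlled_invariant A B H U H"
    unfolding H_eq using assms(4,8) by (intro controlled_invariant_convex_hull_traj) auto
  then have ci: "controlled_invariant A B X U H"
    using HX unfolding controlled_invariant_def by blast
  have cis: "controlled_invariant A B X U (Pre_seq A B H X U t)" for t
    by (rule controlled_invariant_Pre_seq[OF ci])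
  obtain \<eta> where \<eta>: "\<eta> > 0" "H \<subseteq> Pre_seq A B {y. cball y \<eta> \<subseteq> H} H U (Suc (N - 1))"
    using convex_hull_traj_reaches_interior[of U u \<epsilon> A B "N - 1" x0] ball assms(4,7,8)
    unfolding H_eq by blast
  have "hausdorff_converges (Pre_seq A B H X U) (max_controlled_invariant A B X U)"
  proof (rule hausdorff_converges_increasing)
    show "compact (Pre_seq A B H X U t)" for t
      by (rule compact_Pre_seq[OF assms(1,3) compact])
    show "Pre_seq A B H X U t \<noteq> {}" for t
      using Pre_seq_increasing[OF ci, of 0 t] H_ne by auto
    show "compact (max_controlled_invariant A B X U)"
      by (rule compact_max_controlled_invariant[OF assms(1,3)])
    show "Pre_seq A B H X U t \<subseteq> max_controlled_invariant A B X U" for t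
      by (rule max_controlled_invariant_greatest[OF cis])
    show "Pre_seq A B H X U s \<subseteq> Pre_seq A B H X U t" if "s \<le> t" for s t
      by (rule Pre_seq_increasing[OF ci that])
    show "\<exists>t. \<forall>z\<in>max_controlled_invariant A B X U. \<exists>y\<in>Pre_seq A B H X U t. dist z y \<le> e"
      if "e > 0" for e
      by (rule Pre_seq_approaches[OF assms(2) compact_imp_bounded[OF assms(1)] assms(4) HX
            controlled_invariant_max \<eta> H_ne that])
  qed
  then show ?thesis
    using ci cis by blast
qed

end
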